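(* Let $a<b$ be real numbers. A bounded function $f:[a,b]\to\mathbb{R}$ is Riemann integrable on $[a,b]$ if and only if any two of its generalized primitives differ by a constant, that is, for any generalized primitives $F$ and $G$ of $f$ on $[a,b]$ the function $F-G$ is constant on $[a,b]$.
   Context: Let $f:[a,b]\to\mathbb{R}$ be a bounded function. A generalized primitive of $f$ is a function $F:[a,b]\to\mathbb{R}$ such that for all $x,y\in[a,b]$ with $x<y$ we have $$\inf_{x\le z\le y} f(z)\le \frac{F(y)-F(x)}{y-x}\le \sup_{x\le z\le y} f(z).$$ *)

theory Defs
  imports "HOL-Analysis.Analysis"
begin

text \<open>
  Functions on \<open>[a, b]\<close> are total functions on the reals; only their values on \<open>{a..b}\<close> matter.
\<close>

text \<open>
  The classical Riemann integral: unlike in \<^const>\<open>has_integral\<close>, where the fineness of the tagged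
  divisions is controlled by an arbitrary gauge, here it is controlled by a uniform bound on the mesh.
  (A tagged division may contain degenerate one-point intervals; they contribute nothing to the sum.)
\<close>

definition has_riemann_integral ::
    "(real \<Rightarrow> real) \<Rightarrow> real \<Rightarrow> real \<Rightarrow> real \<Rightarrow> bool" where
  "has_riemann_integral f I a b \<longleftrightarrow>
    (\<forall>\<epsilon>>0. \<exists>\<delta>>0. \<forall>p. p tagged_division_of {a..b} \<and> (\<forall>(t, K)\<in>p. diameter K < \<delta>) \<longrightarrow>
      \<bar>(\<Sum>(t, K)\<in>p. measure lborel K * f t) - I\<bar> < \<epsilon>)"

definition riemann_integrable :: "(real \<Rightarrow> real) \<Rightarrow> real \<Rightarrow> real \<Rightarrow> bool" where
  "riemann_integrable f a b \<longleftrightarrow> (\<exists>I. has_riemann_integral f I a b)"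

text \<open>
  To be used only for \<open>f\<close> bounded on \<open>{a..b}\<close>: otherwise the infimum and supremum below are
  unspecified reals.
\<close>

definition generalized_primitive ::
    "(real \<Rightarrow> real) \<Rightarrow> real \<Rightarrow> real \<Rightarrow> (real \<Rightarrow> real) \<Rightarrow> bool" where
  "generalized_primitive f a b F \<longleftrightarrow>
    (\<forall>x\<in>{a..b}. \<forall>y\<in>{a..b}. x < y \<longrightarrow>
      (INF z\<in>{x..y}. f z) \<le> (F y - F x) / (y - x) \<and>
      (F y - F x) / (y - x) \<le> (SUP z\<in>{x..y}. f z))"

end

theory Submission
  imports Defs
begin

text \<open>
  If \<open>f\<close> has Riemann integral \<open>I\<close>, then every generalized primitive \<open>F\<close> satisfies \<open>F b - F a = I\<close>:
  on each interval of a fine division the slope of \<open>F\<close> lies between the infimum and the supremum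
  of \<open>f\<close>, so tags can be chosen where \<open>f\<close> falls below this slope by at most \<open>\<epsilon>\<close>. The increments
  of \<open>F\<close> telescope, so \<open>F b - F a \<le> I\<close> (\<open>riemann_integral_ge_increment\<close>), and the same for \<open>-f\<close>
  and \<open>-F\<close> gives equality. Two generalized primitives
  \<open>F\<close> and \<open>G\<close> may be glued at any \<open>x\<close>, and the glued function is again a generalized primitive.
  Since its total increment is \<open>I\<close> as well, \<open>F\<close> and \<open>G\<close> have the same increment on \<open>[a, x]\<close>.

  Conversely, let \<open>E\<close> be the upper envelope of \<open>f\<close>, the limit of the suprema of \<open>f\<close> over
  \<open>1/(n+1)\<close>-neighbourhoods. It is Lebesgue integrable, and \<open>x \<mapsto> \<integral>\<^sub>a\<^sup>x E\<close> is a generalized primitive because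
  \<open>E\<close> lies between the bounds of \<open>f\<close> on the interior of every interval. The lower envelope
  gives another one. If the two differ by a constant, the envelopes have the same integral over
  \<open>[a, b]\<close>. A Riemann sum of mesh less than \<open>1/(n+1)\<close> is at most the integral of the \<open>n\<close>-th local supremum and
  at least the integral of the \<open>n\<close>-th local infimum. By dominated convergence both of these tend to
  this common value, which is therefore the Riemann integral of \<open>f\<close>.

  The lower envelope is minus the upper envelope of \<open>-f\<close>, so only upper envelopes are studied.
\<close>

section \<open>Generalized primitives\<close>

text \<open>
  Arbitrary bounds \<open>c\<close> in place of the infimum and the supremum make negation, gluing and the
  comparison with integrals into linear arithmetic.
\<close>

lemma generalized_primitive_iff_bounds:
  assumes "bounded (f ` {a..b})"
  shows "generalized_primitive f a b F \<longleftrightarrow>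
    (\<forall>x y c. a \<le> x \<and> x < y \<and> y \<le> b \<longrightarrow>
      ((\<forall>z\<in>{x..y}. f z \<le> c) \<longrightarrow> F y - F x \<le> c * (y - x)) \<and>
      ((\<forall>z\<in>{x..y}. c \<le> f z) \<longrightarrow> c * (y - x) \<le> F y - F x))"
    (is "_ \<longleftrightarrow> ?R")
proof
  assume L: "generalized_primitive f a b F"
  show ?R
  proof (intro allI impI conjI)
    fix x y c assume xy: "a \<le> x \<and> x < y \<and> y \<le> b"
    have slope: "(INF z\<in>{x..y}. f z) \<le> (F y - F x) / (y - x)"
      "(F y - F x) / (y - x) \<le> (SUP z\<in>{x..y}. f z)"
      using L xy unfolding generalized_primitive_def by auto
    have ne: "{x..y} \<noteq> {}"
      using xy by simp
    show "F y - F x \<le> c * (y - x)" if "\<forall>z\<in>{x..y}. f z \<le> c"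
    proof -
      have "(SUP z\<in>{x..y}. f z) \<le> c"
        using that ne by (intro cSUP_least) auto
      with slope have "(F y - F x) / (y - x) \<le> c"
        by linarith
      then show ?thesis
        using xy by (simp add: divide_le_eq)
    qed
    show "c * (y - x) \<le> F y - F x" if "\<forall>z\<in>{x..y}. c \<le> f z"
    proof -
      have "c \<le> (INF z\<in>{x..y}. f z)"
        using that ne by (intro cINF_greatest) auto
      with slope have "c \<le> (F y - F x) / (y - x)"
        by linarith
      then show ?thesis
        using xy by (simp add: le_divide_eq)
    qed
  qed
next
  assume R: ?R
  show "generalized_primitive f a b F"
    unfolding generalized_primitive_def
  proof (intro ballI impI)
    fix x y assume xy: "x \<in> {a..b}" "y \<in> {a..b}" "x < y"
    have "bounded (f ` {x..y})"
      by (rule bounded_subset[OF assms]) (use xy in auto)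
    then have bdd: "bdd_above (f ` {x..y})" "bdd_below (f ` {x..y})"
      by (simp_all add: bounded_imp_bdd_above bounded_imp_bdd_below)
    have "\<forall>z\<in>{x..y}. f z \<le> (SUP z\<in>{x..y}. f z)" "\<forall>z\<in>{x..y}. (INF z\<in>{x..y}. f z) \<le> f z"
      using bdd by (auto intro: cSUP_upper cINF_lower)
    with R xy have "F y - F x \<le> (SUP z\<in>{x..y}. f z) * (y - x)"
      "(INF z\<in>{x..y}. f z) * (y - x) \<le> F y - F x"
      by auto
    then show "(INF z\<in>{x..y}. f z) \<le> (F y - F x) / (y - x) \<and>
        (F y - F x) / (y - x) \<le> (SUP z\<in>{x..y}. f z)"
      using xy by (simp add: divide_le_eq le_divide_eq)
  qed
qed

lemma bounded_uminus_image:
  fixes f :: "'a \<Rightarrow> real"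
  assumes "bounded (f ` S)"
  shows "bounded ((\<lambda>x. - f x) ` S)"
  using assms by (simp add: bounded_iff)

lemma generalized_primitive_uminus:
  assumes bf: "bounded (f ` {a..b})" and F: "generalized_primitive f a b F"
  shows "generalized_primitive (\<lambda>x. - f x) a b (\<lambda>x. - F x)"
  unfolding generalized_primitive_iff_bounds[OF bounded_uminus_image[OF bf]]
proof (intro allI impI conjI)
  fix x y c assume xy: "a \<le> x \<and> x < y \<and> y \<le> b"
  note bounds = F[unfolded generalized_primitive_iff_bounds[OF bf], rule_format, OF xy]
  show "- F y - - F x \<le> c * (y - x)" if "\<forall>z\<in>{x..y}. - f z \<le> c"
  proof -
    have "- c * (y - x) \<le> F y - F x"
      using that by (intro conjunct2[OF bounds, rule_format]) (auto simp: minus_le_iff)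
    then show ?thesis
      by simp
  qed
  show "c * (y - x) \<le> - F y - - F x" if "\<forall>z\<in>{x..y}. c \<le> - f z"
  proof -
    have "F y - F x \<le> - c * (y - x)"
      using that by (intro conjunct1[OF bounds, rule_format]) (auto simp: le_minus_iff)
    then show ?thesis
      by simp
  qed
qed

text \<open>
  An interval straddling the gluing point is cut there: a bound for \<open>f\<close> on the whole interval
  bounds the increments over both pieces, and the bounds add up.
\<close>

lemma generalized_primitive_glue:
  assumes bf: "bounded (f ` {a..b})"
    and F: "generalized_primitive f a b F" and G: "generalized_primitive f a b G"
  shows "generalized_primitive f a b (\<lambda>t. if t \<le> x then F t - F x else G t - G x)"
    (is "generalized_primitive f a b ?H")
  unfolding generalized_primitive_iff_bounds[OF bf]
proof (intro allI impI)
  fix u v c assume uv: "a \<le> u \<and> u < v \<and> v \<le> b"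
  note Fb = F[unfolded generalized_primitive_iff_bounds[OF bf], rule_format]
  note Gb = G[unfolded generalized_primitive_iff_bounds[OF bf], rule_format]
  consider "v \<le> x" | "x \<le> u" | "u < x" "x < v"
    by linarith
  then show "((\<forall>z\<in>{u..v}. f z \<le> c) \<longrightarrow> ?H v - ?H u \<le> c * (v - u)) \<and>
      ((\<forall>z\<in>{u..v}. c \<le> f z) \<longrightarrow> c * (v - u) \<le> ?H v - ?H u)"
  proof cases
    case 1
    then show ?thesis
      using Fb[of u v c] uv by simp
  next
    case 2
    then have "?H v - ?H u = G v - G u"
      using uv by auto
    then show ?thesis
      using Gb[of u v c] uv by simp
  next
    case 3
    then have "?H v - ?H u = (F x - F u) + (G v - G x)" "c * (v - u) = c * (x - u) + c * (v - x)"
      by (auto simp: algebra_simps)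
    then show ?thesis
      using Fb[of u x c] Gb[of x v c] uv 3 by auto
  qed
qed

section \<open>Riemann integrable functions\<close>

lemma has_riemann_integral_uminus:
  assumes "has_riemann_integral f I a b"
  shows "has_riemann_integral (\<lambda>x. - f x) (- I) a b"
proof -
  have eq: "\<bar>(\<Sum>(t, K)\<in>p. measure lborel K * - f t) - - I\<bar> =
      \<bar>(\<Sum>(t, K)\<in>p. measure lborel K * f t) - I\<bar>" for p
    by (simp add: case_prod_unfold sum_negf abs_minus_commute)
  show ?thesis
    using assms unfolding has_riemann_integral_def eq .
qed

lemma retag_division:
  assumes p: "p tagged_division_of S" and s: "\<And>K. K \<in> snd ` p \<Longrightarrow> s K \<in> K"
  shows "(\<lambda>K. (s K, K)) ` snd ` p tagged_division_of S"
proof -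
  define \<D> where "\<D> = snd ` p"
  have D: "\<D> division_of S"
    unfolding \<D>_def by (rule division_of_tagged_division[OF p])
  have mem: "(x, K) \<in> (\<lambda>K. (s K, K)) ` \<D> \<longleftrightarrow> x = s K \<and> K \<in> \<D>" for x K
    by auto
  have s: "\<And>K. K \<in> \<D> \<Longrightarrow> s K \<in> K"
    unfolding \<D>_def by (rule s)
  have "interior K1 \<inter> interior K2 = {}"
    if "x1 = s K1 \<and> K1 \<in> \<D>" "x2 = s K2 \<and> K2 \<in> \<D>" "(x1, K1) \<noteq> (x2, K2)" for x1 K1 x2 K2
    using that by (intro division_ofD(5)[OF D]) auto
  then have "(\<lambda>K. (s K, K)) ` \<D> tagged_division_of S"
    using s division_ofD(1-4,6)[OF D] by (intro tagged_division_ofI) (simp_all add: mem)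
  then show ?thesis
    unfolding \<D>_def .
qed

text \<open>
  If \<open>f\<close> stayed below the slope of \<open>F\<close> by more than \<open>\<epsilon>\<close> on an interval, then the slope
  would exceed the supremum of \<open>f\<close> there.
\<close>

lemma generalized_primitive_tag:
  assumes bf: "bounded (f ` {a..b})" and F: "generalized_primitive f a b F"
    and "0 < \<epsilon>" "a \<le> u" "u \<le> v" "v \<le> b"
  shows "\<exists>s\<in>{u..v}. F v - F u \<le> (f s + \<epsilon>) * (v - u)"
proof (cases "u = v")
  case True
  then show ?thesis by auto
next
  case False
  then have uv: "u < v"
    using assms by simp
  show ?thesis
  proof (rule ccontr)
    assume neg: "\<not> ?thesis"
    define m where "m = (F v - F u) / (v - u)"
    have m: "F v - F u = m * (v - u)"
      using uv by (simp add: m_def)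
    have "\<forall>s\<in>{u..v}. f s \<le> m - \<epsilon>"
      using neg uv by (auto simp: m not_le)
    then have "F v - F u \<le> (m - \<epsilon>) * (v - u)"
      using F[unfolded generalized_primitive_iff_bounds[OF bf]] assms uv by blast
    then show False
      using uv \<open>0 < \<epsilon>\<close> by (simp add: m)
  qed
qed

lemma riemann_integral_ge_increment:
  assumes ab: "a \<le> b" and bf: "bounded (f ` {a..b})"
    and I: "has_riemann_integral f I a b" and F: "generalized_primitive f a b F"
  shows "F b - F a \<le> I"
proof -
  have bound: "F b - F a \<le> I + \<epsilon> * (1 + (b - a))" if e: "0 < \<epsilon>" for \<epsilon>
  proof -
    from I e obtain \<delta> where d: "0 < \<delta>" and
      sums: "\<And>p. p tagged_division_of {a..b} \<Longrightarrow> \<forall>(t, K)\<in>p. diameter K < \<delta> \<Longrightarrow>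
        \<bar>(\<Sum>(t, K)\<in>p. measure lborel K * f t) - I\<bar> < \<epsilon>"
      unfolding has_riemann_integral_def by meson
    have "gauge (\<lambda>x::real. ball x (\<delta> / 3))"
      using d by (intro gauge_ball) simp
    then obtain p where p: "p tagged_division_of {a..b}" "(\<lambda>x. ball x (\<delta> / 3)) fine p"
      using fine_division_exists_real by blast
    have mesh: "diameter K < \<delta>" if "(t, K) \<in> p" for t K
    proof -
      have "diameter K \<le> diameter (ball t (\<delta> / 3))"
        using fineD[OF p(2) that] by (intro diameter_subset) auto
      also have "\<dots> = 2 * (\<delta> / 3)"
        using d by simp
      finally show ?thesis
        using d by simp
    qed
    have "\<exists>s\<in>K. F (Sup K) - F (Inf K) \<le> (f s + \<epsilon>) * measure lborel K" if "K \<in> snd ` p" for K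
    proof -
      from that obtain t where tK: "(t, K) \<in> p"
        by auto
      with p(1) obtain u v where K: "K = {u..v}"
        using tagged_division_ofD(4)[OF p(1) tK] by (auto simp: box_real)
      have "t \<in> K" "K \<subseteq> {a..b}"
        using tagged_division_ofD(2,3)[OF p(1) tK] by auto
      then have uv: "a \<le> u" "u \<le> v" "v \<le> b"
        unfolding K by auto
      show ?thesis
        using generalized_primitive_tag[OF bf F e uv] uv unfolding K by simp
    qed
    then obtain s where s: "\<And>K. K \<in> snd ` p \<Longrightarrow> s K \<in> K"
      "\<And>K. K \<in> snd ` p \<Longrightarrow> F (Sup K) - F (Inf K) \<le> (f (s K) + \<epsilon>) * measure lborel K"
      by metis
    define q where "q = (\<lambda>K. (s K, K)) ` snd ` p"
    have q: "q tagged_division_of {a..b}"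
      unfolding q_def by (rule retag_division[OF p(1) s(1)])
    have "F b - F a = (\<Sum>(t, K)\<in>q. F (Sup K) - F (Inf K))"
      by (rule additive_tagged_division_1[OF ab q, symmetric])
    also have "\<dots> \<le> (\<Sum>(t, K)\<in>q. measure lborel K * f t + \<epsilon> * measure lborel K)"
    proof (rule sum_mono)
      fix z assume "z \<in> q"
      then obtain K where K: "z = (s K, K)" "K \<in> snd ` p"
        unfolding q_def by blast
      show "(case z of (t, K) \<Rightarrow> F (Sup K) - F (Inf K)) \<le>
          (case z of (t, K) \<Rightarrow> measure lborel K * f t + \<epsilon> * measure lborel K)"
        using s(2)[OF K(2)] by (simp add: K(1) algebra_simps)
    qed
    also have "\<dots> = (\<Sum>(t, K)\<in>q. measure lborel K * f t) + \<epsilon> * (\<Sum>(t, K)\<in>q. measure lborel K)"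
      by (simp add: case_prod_unfold sum.distrib sum_distrib_left)
    also have "(\<Sum>(t, K)\<in>q. measure lborel K) = b - a"
      using additive_content_tagged_division[of q a b] q ab by simp
    also have "(\<Sum>(t, K)\<in>q. measure lborel K * f t) < I + \<epsilon>"
    proof -
      have "\<bar>(\<Sum>(t, K)\<in>q. measure lborel K * f t) - I\<bar> < \<epsilon>"
        using mesh by (intro sums[OF q]) (auto simp: q_def)
      then show ?thesis
        by linarith
    qed
    finally show ?thesis
      by (simp add: algebra_simps)
  qed
  show ?thesis
  proof (rule field_le_epsilon)
    fix e :: real assume "0 < e"
    then have "0 < e / (1 + (b - a))"
      using ab by simp
    from bound[OF this] show "F b - F a \<le> I + e"
      using ab by simp
  qed
qed

lemma riemann_integral_eq_increment:
  assumes ab: "a \<le> b" and bf: "bounded (f ` {a..b})"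
    and I: "has_riemann_integral f I a b" and F: "generalized_primitive f a b F"
  shows "F b - F a = I"
proof -
  have "- F b - - F a \<le> - I"
    by (rule riemann_integral_ge_increment[OF ab bounded_uminus_image[OF bf]
        has_riemann_integral_uminus[OF I] generalized_primitive_uminus[OF bf F]])
  with riemann_integral_ge_increment[OF ab bf I F] show ?thesis
    by simp
qed

text \<open>
  The primitive glued from \<open>F\<close> on \<open>[a, x]\<close> and \<open>G\<close> on \<open>[x, b]\<close> has the same total increment as \<open>G\<close>,
  hence \<open>F\<close> and \<open>G\<close> have the same increment on \<open>[a, x]\<close>.
\<close>

lemma generalized_primitives_differ_by_constant:
  assumes ab: "a \<le> b" and bf: "bounded (f ` {a..b})" and I: "has_riemann_integral f I a b"
    and F: "generalized_primitive f a b F" and G: "generalized_primitive f a b G"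
  shows "(\<lambda>x. F x - G x) constant_on {a..b}"
proof -
  have "F x - G x = F a - G a" if x: "x \<in> {a..b}" for x
  proof -
    have "(if b \<le> x then F b - F x else G b - G x) - (if a \<le> x then F a - F x else G a - G x) = I"
      by (rule riemann_integral_eq_increment[OF ab bf I generalized_primitive_glue[OF bf F G]])
    moreover have "G b - G a = I"
      by (rule riemann_integral_eq_increment[OF ab bf I G])
    ultimately show ?thesis
      using x by (auto split: if_splits)
  qed
  then show ?thesis
    unfolding constant_on_def by blast
qed

section \<open>The upper envelope\<close>

definition local_sup :: "(real \<Rightarrow> real) \<Rightarrow> real set \<Rightarrow> real \<Rightarrow> real \<Rightarrow> real" where
  "local_sup f S \<delta> x = (SUP z\<in>S \<inter> ball x \<delta>. f z)"

definition upper_envelope :: "(real \<Rightarrow> real) \<Rightarrow> real set \<Rightarrow> real \<Rightarrow> real" where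
  "upper_envelope f S x = (INF n. local_sup f S (1 / real (Suc n)) x)"

lemma le_local_sup:
  assumes "bounded (f ` S)" "z \<in> S" "dist x z < \<delta>"
  shows "f z \<le> local_sup f S \<delta> x"
  unfolding local_sup_def
proof (rule cSUP_upper)
  show "bdd_above (f ` (S \<inter> ball x \<delta>))"
    by (rule bdd_above_mono[OF bounded_imp_bdd_above[OF assms(1)]]) auto
qed (use assms in auto)

lemma local_sup_le:
  assumes "x \<in> S" "0 < \<delta>" "\<And>z. z \<in> S \<Longrightarrow> dist x z < \<delta> \<Longrightarrow> f z \<le> c"
  shows "local_sup f S \<delta> x \<le> c"
  unfolding local_sup_def by (rule cSUP_least) (use assms in auto)

lemma abs_local_sup_le:
  assumes bf: "bounded (f ` S)" and x: "x \<in> S" and d: "0 < \<delta>"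
    and B: "\<And>z. z \<in> S \<Longrightarrow> \<bar>f z\<bar> \<le> B"
  shows "\<bar>local_sup f S \<delta> x\<bar> \<le> B"
proof -
  have "local_sup f S \<delta> x \<le> B"
    using B by (intro local_sup_le[OF x d]) (simp add: abs_le_iff)
  moreover have "- B \<le> local_sup f S \<delta> x"
    using le_local_sup[OF bf x, of x \<delta>] B[OF x] d by auto
  ultimately show ?thesis
    by simp
qed

text \<open>
  The superlevel sets of the local supremum are open in \<open>S\<close>, being the traces on \<open>S\<close> of unions of
  balls around points where \<open>f\<close> is large; this gives measurability for an arbitrary bounded \<open>f\<close>.
\<close>

lemma local_sup_measurable:
  assumes bf: "bounded (f ` S)" and d: "0 < \<delta>" and S: "S \<in> sets lebesgue"
  shows "local_sup f S \<delta> \<in> borel_measurable (lebesgue_on S)"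
proof (rule borel_measurableI_greater)
  fix y :: real
  have "y < local_sup f S \<delta> x \<longleftrightarrow> (\<exists>z\<in>S. dist x z < \<delta> \<and> y < f z)" if x: "x \<in> S" for x
    using le_local_sup[OF bf, of _ x \<delta>] local_sup_le[OF x d, of f y]
    by (meson less_le_trans not_le)
  then have "{x \<in> space (lebesgue_on S). y < local_sup f S \<delta> x} =
      S \<inter> (\<Union>z\<in>{z \<in> S. y < f z}. ball z \<delta>)"
    by (auto simp: dist_commute)
  moreover have "open (\<Union>z\<in>{z \<in> S. y < f z}. ball z \<delta>)"
    by auto
  ultimately show "{x \<in> space (lebesgue_on S). y < local_sup f S \<delta> x} \<in> sets (lebesgue_on S)"
    using S by (simp add: sets_restrict_space)
qed

lemma local_sup_integrable:
  assumes bf: "bounded (f ` {a..b})" and d: "0 < \<delta>"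
  shows "local_sup f {a..b} \<delta> integrable_on {a..b}"
proof -
  obtain B where B: "\<And>z. z \<in> {a..b} \<Longrightarrow> \<bar>f z\<bar> \<le> B"
    using bf unfolding bounded_iff by (metis imageI real_norm_def)
  show ?thesis
  proof (rule measurable_bounded_by_integrable_imp_integrable)
    show "local_sup f {a..b} \<delta> \<in> borel_measurable (lebesgue_on {a..b})"
      by (rule local_sup_measurable[OF bf d]) simp
    show "(\<lambda>_. B) integrable_on {a..b}"
      by (rule integrable_const_ivl)
    show "norm (local_sup f {a..b} \<delta> x) \<le> B" if "x \<in> {a..b}" for x
      using abs_local_sup_le[OF bf that d B] by simp
  qed simp
qed

lemma local_sup_tendsto_upper_envelope:
  assumes bf: "bounded (f ` S)" and x: "x \<in> S"
  shows "(\<lambda>n. local_sup f S (1 / real (Suc n)) x) \<longlonglongrightarrow> upper_envelope f S x"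
  unfolding upper_envelope_def
proof (rule LIMSEQ_decseq_INF)
  show "bdd_below (range (\<lambda>n. local_sup f S (1 / real (Suc n)) x))"
    by (rule bdd_belowI[of _ "f x"]) (auto intro!: le_local_sup[OF bf x])
  show "decseq (\<lambda>n. local_sup f S (1 / real (Suc n)) x)"
  proof (rule decseq_SucI)
    fix n
    have "1 / real (Suc (Suc n)) \<le> 1 / real (Suc n)"
      by (simp add: frac_le)
    then show "local_sup f S (1 / real (Suc (Suc n))) x \<le> local_sup f S (1 / real (Suc n)) x"
      by (intro local_sup_le[OF x] le_local_sup[OF bf]) auto
  qed
qed

lemma upper_envelope_integral:
  assumes bf: "bounded (f ` {a..b})"
  shows "upper_envelope f {a..b} integrable_on {a..b}"
    and "(\<lambda>n. integral {a..b} (local_sup f {a..b} (1 / real (Suc n)))) \<longlonglongrightarrow>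
      integral {a..b} (upper_envelope f {a..b})"
proof -
  obtain B where B: "\<And>z. z \<in> {a..b} \<Longrightarrow> \<bar>f z\<bar> \<le> B"
    using bf unfolding bounded_iff by (metis imageI real_norm_def)
  note dom = dominated_convergence[of "\<lambda>n. local_sup f {a..b} (1 / real (Suc n))" "{a..b}" "\<lambda>_. B"
      "upper_envelope f {a..b}", OF local_sup_integrable[OF bf] integrable_const_ivl _
      local_sup_tendsto_upper_envelope[OF bf]]
  have "norm (local_sup f {a..b} (1 / real (Suc n)) x) \<le> B" if "x \<in> {a..b}" for n x
    using abs_local_sup_le[OF bf that _ B] by simp
  then show "upper_envelope f {a..b} integrable_on {a..b}"
    and "(\<lambda>n. integral {a..b} (local_sup f {a..b} (1 / real (Suc n)))) \<longlonglongrightarrow>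
      integral {a..b} (upper_envelope f {a..b})"
    using dom by auto
qed

lemma upper_envelope_ge:
  assumes bf: "bounded (f ` S)" and x: "x \<in> S"
  shows "f x \<le> upper_envelope f S x"
  by (rule LIMSEQ_le_const[OF local_sup_tendsto_upper_envelope[OF bf x]])
    (auto intro!: exI[of _ 0] le_local_sup[OF bf x])

text \<open>
  Only interior points are covered: at an endpoint of the interval the envelope also sees the
  values of \<open>f\<close> outside.
\<close>

lemma upper_envelope_le:
  assumes bf: "bounded (f ` S)" and xy: "{x..y} \<subseteq> S" and t: "x < t" "t < y"
    and c: "\<And>z. z \<in> {x..y} \<Longrightarrow> f z \<le> c"
  shows "upper_envelope f S t \<le> c"
proof -
  have "t \<in> S"
    using xy t by auto
  have "0 < min (t - x) (y - t)"
    using t by simp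
  then obtain n where n: "1 / real (Suc n) < min (t - x) (y - t)"
    using nat_approx_posE by blast
  have "local_sup f S (1 / real (Suc k)) t \<le> c" if "n \<le> k" for k
  proof (rule local_sup_le[OF \<open>t \<in> S\<close>])
    fix z assume "dist t z < 1 / real (Suc k)"
    also have "\<dots> \<le> 1 / real (Suc n)"
      using that by (simp add: frac_le)
    finally show "f z \<le> c"
      using n by (intro c) (auto simp: dist_real_def)
  qed simp
  then show ?thesis
    by (intro LIMSEQ_le_const2[OF local_sup_tendsto_upper_envelope[OF bf \<open>t \<in> S\<close>]]) blast
qed

lemma integral_upper_envelope_generalized_primitive:
  assumes bf: "bounded (f ` {a..b})"
  shows "generalized_primitive f a b (\<lambda>x. integral {a..x} (upper_envelope f {a..b}))"
  unfolding generalized_primitive_iff_bounds[OF bf]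
proof (intro allI impI)
  fix x y c assume xy: "a \<le> x \<and> x < y \<and> y \<le> b"
  let ?E = "upper_envelope f {a..b}"
  have sub: "{x..y} \<subseteq> {a..b}"
    using xy by auto
  have int: "?E integrable_on {u..v}" if "a \<le> u" "v \<le> b" for u v
    using that by (intro integrable_on_subinterval[OF upper_envelope_integral(1)[OF bf]]) auto
  have "integral {a..x} ?E + integral {x..y} ?E = integral {a..y} ?E"
    using xy by (intro Henstock_Kurzweil_Integration.integral_combine int) auto
  then have incr: "integral {a..y} ?E - integral {a..x} ?E = integral {x<..<y} ?E"
    by (simp add: integral_open_interval_real)
  have intE: "?E integrable_on {x<..<y}"
    using int xy by (simp add: integrable_on_open_interval_real)
  have const: "integral {x<..<y} (\<lambda>_. c) = c * (y - x)"
    "(\<lambda>_. c) integrable_on {x<..<y}"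
    using xy by (simp_all add: integral_open_interval_real[symmetric]
        integrable_on_open_interval_real integrable_const_ivl)
  have "integral {x<..<y} ?E \<le> c * (y - x)" if "\<forall>z\<in>{x..y}. f z \<le> c"
    unfolding const(1)[symmetric]
    using that by (intro integral_le[OF intE const(2)] upper_envelope_le[OF bf sub]) auto
  moreover have "c * (y - x) \<le> integral {x<..<y} ?E" if "\<forall>z\<in>{x..y}. c \<le> f z"
    unfolding const(1)[symmetric]
  proof (rule integral_le[OF const(2) intE])
    fix t assume "t \<in> {x<..<y}"
    then have "c \<le> f t" "t \<in> {a..b}"
      using that sub by auto
    then show "c \<le> ?E t"
      using upper_envelope_ge[OF bf] by fastforce
  qed
  ultimately show "((\<forall>z\<in>{x..y}. f z \<le> c) \<longrightarrow>
        integral {a..y} ?E - integral {a..x} ?E \<le> c * (y - x)) \<and>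
      ((\<forall>z\<in>{x..y}. c \<le> f z) \<longrightarrow> c * (y - x) \<le> integral {a..y} ?E - integral {a..x} ?E)"
    by (simp add: incr)
qed

section \<open>Riemann sums and the integrals of the envelopes\<close>

text \<open>
  The tag of an interval shorter than \<open>\<delta>\<close> is within \<open>\<delta>\<close> of every point of the interval, so the
  constant value at the tag is below the local supremum on the whole interval.
\<close>

lemma riemann_sum_le_integral_local_sup:
  assumes bf: "bounded (f ` {a..b})" and d: "0 < \<delta>"
    and p: "p tagged_division_of {a..b}" and mesh: "\<forall>(t, K)\<in>p. diameter K < \<delta>"
  shows "(\<Sum>(t, K)\<in>p. measure lborel K * f t) \<le> integral {a..b} (local_sup f {a..b} \<delta>)"
proof -
  let ?M = "local_sup f {a..b} \<delta>"
  have "measure lborel K * f t \<le> integral K ?M" if tK: "(t, K) \<in> p" for t K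
  proof -
    obtain u v where K: "K = {u..v}"
      using tagged_division_ofD(4)[OF p tK] by (auto simp: box_real)
    have t: "t \<in> K" and sub: "K \<subseteq> {a..b}"
      using tagged_division_ofD(2,3)[OF p tK] by auto
    have "integral K (\<lambda>_. f t) \<le> integral K ?M"
    proof (rule integral_le)
      show "(\<lambda>_. f t) integrable_on K"
        unfolding K by (rule integrable_const_ivl)
      show "?M integrable_on K"
        using integrable_on_subinterval[OF local_sup_integrable[OF bf d]] sub unfolding K by blast
      fix x assume "x \<in> K"
      then have "dist x t \<le> diameter K"
        using t by (intro diameter_bounded_bound) (simp_all add: K)
      also have "\<dots> < \<delta>"
        using mesh tK by auto
      finally show "f t \<le> ?M x"
        using t sub by (intro le_local_sup[OF bf]) auto
    qed
    moreover have "integral K (\<lambda>_. f t) = measure lborel K * f t"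
      unfolding K by simp
    ultimately show ?thesis
      by simp
  qed
  then have "(\<Sum>(t, K)\<in>p. measure lborel K * f t) \<le> (\<Sum>(t, K)\<in>p. integral K ?M)"
    by (intro sum_mono) auto
  also have "\<dots> = integral {a..b} ?M"
    using integral_combine_tagged_division_topdown[of ?M a b p] local_sup_integrable[OF bf d] p
    by simp
  finally show ?thesis .
qed

lemma riemann_sums_eventually_below:
  assumes bf: "bounded (f ` {a..b})" and e: "0 < \<epsilon>"
  shows "\<exists>\<delta>>0. \<forall>p. p tagged_division_of {a..b} \<and> (\<forall>(t, K)\<in>p. diameter K < \<delta>) \<longrightarrow>
    (\<Sum>(t, K)\<in>p. measure lborel K * f t) < integral {a..b} (upper_envelope f {a..b}) + \<epsilon>"
proof -
  have "\<forall>\<^sub>F n in sequentially. integral {a..b} (local_sup f {a..b} (1 / real (Suc n))) <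
      integral {a..b} (upper_envelope f {a..b}) + \<epsilon>"
    using e by (intro order_tendstoD(2)[OF upper_envelope_integral(2)[OF bf]]) simp
  then obtain n where n: "integral {a..b} (local_sup f {a..b} (1 / real (Suc n))) <
      integral {a..b} (upper_envelope f {a..b}) + \<epsilon>"
    using eventually_sequentially by auto
  show ?thesis
  proof (intro exI conjI allI impI)
    fix p assume "p tagged_division_of {a..b} \<and> (\<forall>(t, K)\<in>p. diameter K < 1 / real (Suc n))"
    then show "(\<Sum>(t, K)\<in>p. measure lborel K * f t) <
        integral {a..b} (upper_envelope f {a..b}) + \<epsilon>"
      using riemann_sum_le_integral_local_sup[OF bf, of "1 / real (Suc n)" p] n by simp
  qed simp
qed

lemma riemann_integrable_if_envelopes_agree:
  assumes bf: "bounded (f ` {a..b})"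
    and eq: "integral {a..b} (upper_envelope (\<lambda>x. - f x) {a..b}) =
      - integral {a..b} (upper_envelope f {a..b})"
  shows "riemann_integrable f a b"
proof -
  let ?I = "integral {a..b} (upper_envelope f {a..b})"
  have "has_riemann_integral f ?I a b"
    unfolding has_riemann_integral_def
  proof (intro allI impI)
    fix \<epsilon> :: real assume e: "0 < \<epsilon>"
    obtain d1 where d1: "0 < d1" "\<And>p. p tagged_division_of {a..b} \<Longrightarrow>
        \<forall>(t, K)\<in>p. diameter K < d1 \<Longrightarrow> (\<Sum>(t, K)\<in>p. measure lborel K * f t) < ?I + \<epsilon>"
      using riemann_sums_eventually_below[OF bf e] by meson
    obtain d2 where d2: "0 < d2" "\<And>p. p tagged_division_of {a..b} \<Longrightarrow>
        \<forall>(t, K)\<in>p. diameter K < d2 \<Longrightarrow> (\<Sum>(t, K)\<in>p. measure lborel K * - f t) < - ?I + \<epsilon>"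
      using riemann_sums_eventually_below[OF bounded_uminus_image[OF bf] e] unfolding eq by meson
    show "\<exists>\<delta>>0. \<forall>p. p tagged_division_of {a..b} \<and> (\<forall>(t, K)\<in>p. diameter K < \<delta>) \<longrightarrow>
        \<bar>(\<Sum>(t, K)\<in>p. measure lborel K * f t) - ?I\<bar> < \<epsilon>"
    proof (intro exI[of _ "min d1 d2"] conjI allI impI)
      fix p assume p: "p tagged_division_of {a..b} \<and> (\<forall>(t, K)\<in>p. diameter K < min d1 d2)"
      then have "(\<Sum>(t, K)\<in>p. measure lborel K * f t) < ?I + \<epsilon>"
        by (intro d1) auto
      moreover have "(\<Sum>(t, K)\<in>p. measure lborel K * - f t) < - ?I + \<epsilon>"
        using p by (intro d2) auto
      ultimately show "\<bar>(\<Sum>(t, K)\<in>p. measure lborel K * f t) - ?I\<bar> < \<epsilon>"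
        by (simp add: case_prod_unfold sum_negf abs_less_iff)
    qed (use d1 d2 in simp)
  qed
  then show ?thesis
    unfolding riemann_integrable_def by blast
qed

section \<open>The characterization\<close>

theorem theorem2p4:
  fixes a b :: real and f :: "real \<Rightarrow> real"
  assumes "a < b" and "bounded (f ` {a..b})"
  shows "riemann_integrable f a b \<longleftrightarrow>
    (\<forall>F G. generalized_primitive f a b F \<and> generalized_primitive f a b G \<longrightarrow>
      (\<lambda>x. F x - G x) constant_on {a..b})"
proof
  assume "riemann_integrable f a b"
  then show "\<forall>F G. generalized_primitive f a b F \<and> generalized_primitive f a b G \<longrightarrow>
      (\<lambda>x. F x - G x) constant_on {a..b}"
    using assms generalized_primitives_differ_by_constant[of a b f]
    unfolding riemann_integrable_def by auto
next
  assume const: "\<forall>F G. generalized_primitive f a b F \<and> generalized_primitive f a b G \<longrightarrow>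
      (\<lambda>x. F x - G x) constant_on {a..b}"
  let ?F = "\<lambda>x. integral {a..x} (upper_envelope f {a..b})"
  (* Integrals of the upper and of the lower envelope of f. *)
  let ?G = "\<lambda>x. - integral {a..x} (upper_envelope (\<lambda>x. - f x) {a..b})"
  have "generalized_primitive f a b ?F"
    by (rule integral_upper_envelope_generalized_primitive[OF assms(2)])
  moreover have "generalized_primitive f a b ?G"
    using generalized_primitive_uminus[OF bounded_uminus_image[OF assms(2)]
        integral_upper_envelope_generalized_primitive[OF bounded_uminus_image[OF assms(2)]]]
    by simp
  ultimately have "(\<lambda>x. ?F x - ?G x) constant_on {a..b}"
    using const by blast
  then obtain k where k: "\<And>x. x \<in> {a..b} \<Longrightarrow> ?F x - ?G x = k"
    unfolding constant_on_def by blast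
  (* Both integrals vanish over the degenerate interval [a, a]. *)
  have "?F b - ?G b = ?F a - ?G a"
    using k[of a] k[of b] \<open>a < b\<close> by simp
  also have "\<dots> = 0"
    by simp
  finally show "riemann_integrable f a b"
    by (intro riemann_integrable_if_envelopes_agree[OF assms(2)]) simp
qed

end
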